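(* Let $N\ge0$ and let $|\mathcal{C}_j^X(N)|=\#\{\mu\in W\Lambda_j:\ \mathrm{ht}(\Lambda_j-\mu)=N\}$ be the number of $j$-core abaci of type $X$ of height $N$. Then $$|\mathcal{C}_j^X(N)|=\begin{cases}\frac1{24}r_3(8N+6), & X=D_3^{(2)},\ j=2,\ N\text{ even};\\ \frac1{48}r_3(8N+6), & X=D_3^{(2)},\ j=2,\ N\text{ odd};\\ \frac1{12}r_3(6N+2), & X=B_3^{(1)},\ j=2,\ N\text{ odd}.\end{cases}$$
   Context: The types are given by their Cartan matrices $(a_{ik})=(\langle\alpha_i^\vee,\alpha_k\rangle)$, $i,k\in\{0,1,2,3\}$. - $D_3^{(2)}$ (the paper's notation, rank $3$; Kac's $D_4^{(2)}$): rows $(2,-2,0,0),(-1,2,-1,0),(0,-1,2,-1),(0,0,-2,2)$. - $B_3^{(1)}$: rows $(2,0,-1,0),(0,2,-1,0),(-1,-1,2,-1),(0,0,-2,2)$. $\Lambda_j$ is the fundamental weight with $\langle\Lambda_j,\alpha_k^\vee\rangle=\delta_{jk}$. $W$ is generated by $\sigma_i(v)=v-\langle v,\alpha_i^\vee\rangle\alpha_i$. $\mathrm{ht}(\sum k_i\alpha_i)=\sum k_i$. In the paper's abacus model, $j$-core abaci of type $X$ correspond bijectively to elements $\mu=\Lambda_j-\beta$ of $W\Lambda_j$, with height $\mathrm{ht}(\beta)$. $r_3(n)$ is the number of $(x,y,z)\in\mathbb{Z}^3$ with $x^2+y^2+z^2=n$. *)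

theory Defs
  imports "HOL-Analysis.Analysis" "HOL-Algebra.Bij" "HOL-Algebra.Generated_Groups"
begin

text \<open>\<open>D32\<close> is Kac's type $D_4^{(2)}$, written $D_3^{(2)}$ when indexed by its rank.\<close>

datatype affine_type = D32 | B31

text \<open>\<open>cartan X i k\<close> is the pairing of the \<open>i\<close>-th simple coroot with the \<open>k\<close>-th simple root,
  so rows are indexed by coroots; only indices below 4 are meaningful.\<close>

fun cartan_rows :: "affine_type \<Rightarrow> int list list" where
  "cartan_rows D32 = [[2, -2, 0, 0], [-1, 2, -1, 0], [0, -1, 2, -1], [0, 0, -2, 2]]"
| "cartan_rows B31 = [[2, 0, -1, 0], [0, 2, -1, 0], [-1, -1, 2, -1], [0, 0, -2, 2]]"

definition cartan :: "affine_type \<Rightarrow> nat \<Rightarrow> nat \<Rightarrow> int" where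
  "cartan X i k = cartan_rows X ! i ! k"

text \<open>The weight space is a real vector space \<open>'v\<close>; the coroots enter as the linear functionals
  \<open>coroot i\<close>, so that \<open>coroot i v\<close> is the pairing of \<open>v\<close> with the \<open>i\<close>-th simple coroot. The affine
  Cartan matrices are singular, so linear independence of the simple roots is a separate
  requirement, and a fundamental weight is determined only up to a vector on which all coroots
  vanish. The locale admits every choice.\<close>

locale affine_weights =
  fixes X :: affine_type
    and \<alpha> :: "nat \<Rightarrow> 'v::real_vector"
    and coroot :: "nat \<Rightarrow> 'v \<Rightarrow> real"
    and \<Lambda> :: "nat \<Rightarrow> 'v"
  assumes linear_coroot: "i < 4 \<Longrightarrow> linear (coroot i)"
    and inj_roots: "inj_on \<alpha> {..<4}"
    and independent_roots: "independent (\<alpha> ` {..<4})"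
    and coroot_root: "i < 4 \<Longrightarrow> k < 4 \<Longrightarrow> coroot i (\<alpha> k) = of_int (cartan X i k)"
    and coroot_fundamental: "j < 4 \<Longrightarrow> k < 4 \<Longrightarrow> coroot k (\<Lambda> j) = (if j = k then 1 else 0)"

definition reflection ::
  "(nat \<Rightarrow> 'v::real_vector) \<Rightarrow> (nat \<Rightarrow> 'v \<Rightarrow> real) \<Rightarrow> nat \<Rightarrow> 'v \<Rightarrow> 'v" where
  "reflection \<alpha> coroot i v = v - coroot i v *\<^sub>R \<alpha> i"

definition weyl_group ::
  "(nat \<Rightarrow> 'v::real_vector) \<Rightarrow> (nat \<Rightarrow> 'v \<Rightarrow> real) \<Rightarrow> ('v \<Rightarrow> 'v) set" where
  "weyl_group \<alpha> coroot = generate (BijGroup UNIV) (reflection \<alpha> coroot ` {..<4})"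

definition weyl_orbit ::
  "(nat \<Rightarrow> 'v::real_vector) \<Rightarrow> (nat \<Rightarrow> 'v \<Rightarrow> real) \<Rightarrow> 'v \<Rightarrow> 'v set" where
  "weyl_orbit \<alpha> coroot v = (\<lambda>w. w v) ` weyl_group \<alpha> coroot"

text \<open>The height is the sum of the coordinates with respect to the simple roots. Since
  \<^const>\<open>representation\<close> is zero outside the span, it is meant for vectors in the span of the
  simple roots only; \<open>\<Lambda> j - \<mu>\<close> is such a vector for every \<open>\<mu>\<close> in the Weyl orbit of \<open>\<Lambda> j\<close>.\<close>

definition ht :: "(nat \<Rightarrow> 'v::real_vector) \<Rightarrow> 'v \<Rightarrow> real" where
  "ht \<alpha> \<beta> = (\<Sum>i<4. representation (\<alpha> ` {..<4}) \<beta> (\<alpha> i))"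

text \<open>The core abaci of height \<open>N\<close>, identified with the orbit elements that they encode.\<close>

definition cores ::
  "(nat \<Rightarrow> 'v::real_vector) \<Rightarrow> (nat \<Rightarrow> 'v \<Rightarrow> real) \<Rightarrow> (nat \<Rightarrow> 'v) \<Rightarrow> nat \<Rightarrow> nat \<Rightarrow> 'v set" where
  "cores \<alpha> coroot \<Lambda> j N = {\<mu> \<in> weyl_orbit \<alpha> coroot (\<Lambda> j). ht \<alpha> (\<Lambda> j - \<mu>) = real N}"

definition r3 :: "nat \<Rightarrow> nat" where
  "r3 n = card {(x::int, y::int, z::int). x\<^sup>2 + y\<^sup>2 + z\<^sup>2 = int n}"

end

theory Submission
  imports Defs
begin

text \<open>Writing \<open>\<mu> \<in> W\<Lambda>\<^sub>2\<close> as \<open>\<Lambda>\<^sub>2 - \<beta>\<close>, its image modulo the null root is a vector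
  \<open>(x, y, z) \<in> \<int>\<^sup>3\<close>, on which the generators act by signed permutations and one affine
  reflection. The invariance of the quadratic form recovers \<open>\<beta>\<close> from \<open>(x, y, z)\<close>, and descent to
  the fundamental alcove shows that the orbit of \<open>(1, 1, 0)\<close> consists of all vectors with
  exactly two odd entries. Completing the square in the height turns \<open>ht \<beta> = N\<close> into
  \<open>(4x - 3)\<^sup>2 + (4y - 2)\<^sup>2 + (4z - 1)\<^sup>2 = 8N + 6\<close> for \<open>D\<^sub>3\<^sup>(\<^sup>2\<^sup>)\<close> and into
  \<open>(3x - 3)\<^sup>2 + (3y - 2)\<^sup>2 + (3z - 1)\<^sup>2 = 6N + 2\<close> for \<open>B\<^sub>3\<^sup>(\<^sup>1\<^sup>)\<close>. Congruences modulo 8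
  (respectively 3) show that, up to a rotation of the three squares and two sign changes, every
  representation has this form. It remains to see which solutions have exactly two odd entries:
  for \<open>B\<^sub>3\<^sup>(\<^sup>1\<^sup>)\<close> and odd \<open>N\<close> all of them, by a congruence modulo 4. For \<open>D\<^sub>3\<^sup>(\<^sup>2\<^sup>)\<close>,
  \<open>N\<close> has the parity of \<open>x + z + 1\<close>, and the symmetries \<open>y \<mapsto> 1 - y\<close> and
  \<open>(x, z) \<mapsto> (1 - z, 1 - x)\<close> show that one half (\<open>N\<close> even) or one quarter (\<open>N\<close> odd)
  of them do.\<close>

section \<open>Orbits of the Weyl group\<close>

context affine_weights
begin

lemma coroot_diff: "i < 4 \<Longrightarrow> coroot i (v - w) = coroot i v - coroot i w"
  by (rule linear_diff[OF linear_coroot])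

lemma coroot_scale: "i < 4 \<Longrightarrow> coroot i (c *\<^sub>R v) = c * coroot i v"
  by (simp add: linear_cmul[OF linear_coroot])

lemma coroot_sum: "i < 4 \<Longrightarrow> coroot i (\<Sum>k\<in>A. f k) = (\<Sum>k\<in>A. coroot i (f k))"
  by (rule linear_sum[OF linear_coroot])

lemma reflection_involutive:
  assumes "i < 4"
  shows "reflection \<alpha> coroot i (reflection \<alpha> coroot i v) = v"
proof -
  have "cartan X i i = 2"
    using assms by (cases X) (auto simp: cartan_def less_Suc_eq numeral_eq_Suc)
  then show ?thesis
    using assms coroot_root[of i i]
    by (simp add: reflection_def coroot_diff coroot_scale)
qed

lemma reflection_Bij: "i < 4 \<Longrightarrow> reflection \<alpha> coroot i \<in> Bij UNIV"
  unfolding Bij_def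
  by (auto simp: extensional_def reflection_involutive
      intro!: bij_betwI[where g = "reflection \<alpha> coroot i"])

text \<open>Generated groups also adjoin inverses of the generators; as reflections are their own
  inverses, closure under reflections is all that has to be checked.\<close>

lemma inv_reflection:
  assumes "i < 4"
  shows "inv\<^bsub>BijGroup UNIV\<^esub> (reflection \<alpha> coroot i) = reflection \<alpha> coroot i"
proof -
  interpret group "BijGroup (UNIV :: 'v set)" by (rule group_BijGroup)
  have "reflection \<alpha> coroot i \<otimes>\<^bsub>BijGroup UNIV\<^esub> reflection \<alpha> coroot i = \<one>\<^bsub>BijGroup UNIV\<^esub>"
    using assms reflection_Bij
    by (auto simp: BijGroup_def compose_def reflection_involutive)
  then show ?thesis
    using assms reflection_Bij by (intro inv_equality) (auto simp: BijGroup_def)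
qed

lemma weyl_group_Bij: "w \<in> weyl_group \<alpha> coroot \<Longrightarrow> w \<in> Bij UNIV"
proof -
  interpret group "BijGroup (UNIV :: 'v set)" by (rule group_BijGroup)
  assume "w \<in> weyl_group \<alpha> coroot"
  moreover have "reflection \<alpha> coroot ` {..<4} \<subseteq> carrier (BijGroup UNIV)"
    using reflection_Bij by (auto simp: BijGroup_def)
  ultimately have "w \<in> carrier (BijGroup UNIV)"
    unfolding weyl_group_def using generate_in_carrier by blast
  then show ?thesis by (simp add: BijGroup_def)
qed

lemma mult_BijGroup:
  "f \<in> Bij UNIV \<Longrightarrow> g \<in> Bij UNIV \<Longrightarrow> f \<otimes>\<^bsub>BijGroup UNIV\<^esub> g = f \<circ> g"
  by (auto simp: BijGroup_def compose_def)

lemma weyl_orbit_self: "v \<in> weyl_orbit \<alpha> coroot v"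
proof -
  have "\<one>\<^bsub>BijGroup UNIV\<^esub> \<in> weyl_group \<alpha> coroot"
    unfolding weyl_group_def by (rule generate.one)
  moreover have "\<one>\<^bsub>BijGroup UNIV\<^esub> v = v" by (simp add: BijGroup_def)
  ultimately show ?thesis unfolding weyl_orbit_def by (metis imageI)
qed

lemma weyl_orbit_reflection:
  assumes "i < 4" "u \<in> weyl_orbit \<alpha> coroot v"
  shows "reflection \<alpha> coroot i u \<in> weyl_orbit \<alpha> coroot v"
proof -
  obtain w where w: "w \<in> weyl_group \<alpha> coroot" "u = w v"
    using assms(2) by (auto simp: weyl_orbit_def)
  have "reflection \<alpha> coroot i \<otimes>\<^bsub>BijGroup UNIV\<^esub> w \<in> weyl_group \<alpha> coroot"
    using w(1) assms(1) unfolding weyl_group_def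
    by (auto intro: generate.eng generate.incl)
  then have "reflection \<alpha> coroot i \<circ> w \<in> weyl_group \<alpha> coroot"
    using w(1) assms(1) by (simp add: mult_BijGroup reflection_Bij weyl_group_Bij)
  then show ?thesis
    unfolding weyl_orbit_def w(2) by (rule image_eqI[rotated]) simp
qed

lemma weyl_orbit_subset:
  assumes "v \<in> S" and S: "\<And>i u. i < 4 \<Longrightarrow> u \<in> S \<Longrightarrow> reflection \<alpha> coroot i u \<in> S"
  shows "weyl_orbit \<alpha> coroot v \<subseteq> S"
proof -
  \<comment> \<open>Quantifying over all of \<open>S\<close> lets the product case chain its two
    induction hypotheses.\<close>
  have "\<forall>u\<in>S. w u \<in> S" if "w \<in> generate (BijGroup UNIV) (reflection \<alpha> coroot ` {..<4})" for w
    using that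
  proof (induction rule: generate.induct)
    case (eng g h)
    then show ?case
      using weyl_group_Bij by (simp add: weyl_group_def mult_BijGroup)
  next
    case one
    then show ?case by (simp add: BijGroup_def)
  next
    case (inv h)
    then show ?case using S by (auto simp: inv_reflection)
  qed (use S in auto)
  then show ?thesis
    using assms(1) by (auto simp: weyl_orbit_def weyl_group_def)
qed

section \<open>Coordinates with respect to the simple roots\<close>

lemma ht_combination: "ht \<alpha> (\<Sum>i<4. c i *\<^sub>R \<alpha> i) = (\<Sum>i<4. c i)"
proof -
  have "representation (\<alpha> ` {..<4}) (\<Sum>k<4. c k *\<^sub>R \<alpha> k) (\<alpha> i) = c i" if "i < 4" for i
  proof -
    have "representation (\<alpha> ` {..<4}) (\<Sum>k<4. c k *\<^sub>R \<alpha> k) (\<alpha> i)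
        = (\<Sum>k<4. c k * representation (\<alpha> ` {..<4}) (\<alpha> k) (\<alpha> i))"
      using independent_roots
      by (subst representation_sum)
        (simp_all add: representation_scale span_base span_scale)
    also have "\<dots> = (\<Sum>k<4. if k = i then c k else 0)"
      using independent_roots inj_roots that
      by (intro sum.cong) (auto simp: representation_basis inj_on_eq_iff)
    also have "\<dots> = c i" using that by simp
    finally show ?thesis .
  qed
  then show ?thesis by (simp add: ht_def)
qed

lemma combination_eq_iff:
  "(\<Sum>i<4. c i *\<^sub>R \<alpha> i) = (\<Sum>i<4. d i *\<^sub>R \<alpha> i) \<longleftrightarrow> (\<forall>i<4. c i = d i)"
proof
  assume eq: "(\<Sum>i<4. c i *\<^sub>R \<alpha> i) = (\<Sum>i<4. d i *\<^sub>R \<alpha> i)"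
  \<comment> \<open>Independence concerns a set of vectors, so the index of a root is read off
    through \<open>inv_into\<close>.\<close>
  have "(\<Sum>v\<in>\<alpha> ` {..<4}. (c (inv_into {..<4} \<alpha> v) - d (inv_into {..<4} \<alpha> v)) *\<^sub>R v) = 0"
    using eq inj_roots by (simp add: sum.reindex scaleR_left_diff_distrib sum_subtractf)
  then have "c (inv_into {..<4} \<alpha> v) - d (inv_into {..<4} \<alpha> v) = 0" if "v \<in> \<alpha> ` {..<4}" for v
    using independentD[OF independent_roots _ subset_refl _ that,
        where u = "\<lambda>v. c (inv_into {..<4} \<alpha> v) - d (inv_into {..<4} \<alpha> v)"] by simp
  then show "\<forall>i<4. c i = d i"
    using inj_roots by fastforce
qed simp

end

section \<open>The orbit of the second fundamental weight\<close>

text \<open>The coordinates are those with \<open>\<alpha>\<^sub>1 = e\<^sub>1 - e\<^sub>2\<close>, \<open>\<alpha>\<^sub>2 = e\<^sub>2 - e\<^sub>3\<close>,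
  \<open>\<alpha>\<^sub>3 = e\<^sub>3\<close> and, modulo the null root, \<open>\<alpha>\<^sub>0 = - e\<^sub>1\<close> for \<^const>\<open>D32\<close> and
  \<open>\<alpha>\<^sub>0 = - e\<^sub>1 - e\<^sub>2\<close> for \<^const>\<open>B31\<close>. The constant 2 is the level of \<open>\<Lambda>\<^sub>2\<close>.\<close>

definition point_reflection :: "affine_type \<Rightarrow> nat \<Rightarrow> int \<times> int \<times> int \<Rightarrow> int \<times> int \<times> int" where
  "point_reflection X i = (\<lambda>(x, y, z).
     [case X of D32 \<Rightarrow> (2 - x, y, z) | B31 \<Rightarrow> (2 - y, 2 - x, z),
      (y, x, z), (x, z, y), (x, y, - z)] ! i)"

text \<open>The coefficient of \<open>\<alpha>\<^sub>0\<close> comes from the invariance of the norm along the orbit.\<close>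

definition root_coeff :: "affine_type \<Rightarrow> int \<times> int \<times> int \<Rightarrow> nat \<Rightarrow> real" where
  "root_coeff X = (\<lambda>(x, y, z) i.
     let q = of_int (x\<^sup>2 + y\<^sup>2 + z\<^sup>2) in
     (case X of
       D32 \<Rightarrow> [q / 2 - 1, q / 2 - x, q / 2 + 1 - x - y, q / 2 + 1 - x - y - z]
     | B31 \<Rightarrow> [q / 4 - 1 / 2, q / 4 + 1 / 2 - x, q / 2 + 1 - x - y, q / 2 + 1 - x - y - z]) ! i)"

text \<open>The value of the coroots on the weight that the triple encodes; the constant in entry 0
  is the level.\<close>

definition pairing :: "affine_type \<Rightarrow> int \<times> int \<times> int \<Rightarrow> nat \<Rightarrow> int" where
  "pairing X = (\<lambda>(x, y, z) i.
     [case X of D32 \<Rightarrow> 2 - 2 * x | B31 \<Rightarrow> 2 - x - y, x - y, y - z, 2 * z] ! i)"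

definition two_odd :: "(int \<times> int \<times> int) set" where
  "two_odd = {(x, y, z). odd x \<and> odd y \<and> even z \<or> odd x \<and> even y \<and> odd z \<or>
     even x \<and> odd y \<and> odd z}"

text \<open>Up to the factors 16 and 9 this is the squared distance to (3/4, 1/2, 1/4) and to (1,
  2/3, 1/3). Both centres are interior to the fundamental alcove, so the same quantity measures the
  height and drives the descent.\<close>

fun shifted_norm :: "affine_type \<Rightarrow> int \<times> int \<times> int \<Rightarrow> int" where
  "shifted_norm D32 (x, y, z) = (4 * x - 3)\<^sup>2 + (4 * y - 2)\<^sup>2 + (4 * z - 1)\<^sup>2"
| "shifted_norm B31 (x, y, z) = (3 * x - 3)\<^sup>2 + (3 * y - 2)\<^sup>2 + (3 * z - 1)\<^sup>2"

lemma point_reflection_simps: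
  "point_reflection D32 0 (x, y, z) = (2 - x, y, z)"
  "point_reflection B31 0 (x, y, z) = (2 - y, 2 - x, z)"
  "point_reflection X (Suc 0) (x, y, z) = (y, x, z)"
  "point_reflection X 2 (x, y, z) = (x, z, y)"
  "point_reflection X 3 (x, y, z) = (x, y, - z)"
  by (simp_all add: point_reflection_def)

lemma root_coeff_simps:
  "root_coeff D32 (x, y, z) 0 = (x\<^sup>2 + y\<^sup>2 + z\<^sup>2) / 2 - 1"
  "root_coeff D32 (x, y, z) (Suc 0) = (x\<^sup>2 + y\<^sup>2 + z\<^sup>2) / 2 - x"
  "root_coeff D32 (x, y, z) 2 = (x\<^sup>2 + y\<^sup>2 + z\<^sup>2) / 2 + 1 - x - y"
  "root_coeff D32 (x, y, z) 3 = (x\<^sup>2 + y\<^sup>2 + z\<^sup>2) / 2 + 1 - x - y - z"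
  "root_coeff B31 (x, y, z) 0 = (x\<^sup>2 + y\<^sup>2 + z\<^sup>2) / 4 - 1 / 2"
  "root_coeff B31 (x, y, z) (Suc 0) = (x\<^sup>2 + y\<^sup>2 + z\<^sup>2) / 4 + 1 / 2 - x"
  "root_coeff B31 (x, y, z) 2 = (x\<^sup>2 + y\<^sup>2 + z\<^sup>2) / 2 + 1 - x - y"
  "root_coeff B31 (x, y, z) 3 = (x\<^sup>2 + y\<^sup>2 + z\<^sup>2) / 2 + 1 - x - y - z"
  by (simp_all add: root_coeff_def Let_def)

lemma pairing_simps:
  "pairing D32 (x, y, z) 0 = 2 - 2 * x"
  "pairing B31 (x, y, z) 0 = 2 - x - y"
  "pairing X (x, y, z) (Suc 0) = x - y"
  "pairing X (x, y, z) 2 = y - z"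
  "pairing X (x, y, z) 3 = 2 * z"
  by (simp_all add: pairing_def)

lemma all_less_4: "(\<forall>i<4. P i) \<longleftrightarrow> P 0 \<and> P (Suc 0) \<and> P 2 \<and> P (3::nat)"
  by (auto simp: less_Suc_eq numeral_eq_Suc)

lemma sum_less_4:
  fixes f :: "nat \<Rightarrow> 'a::comm_monoid_add"
  shows "(\<Sum>k<4. f k) = f 0 + f (Suc 0) + f 2 + f 3"
  by (simp add: eval_nat_numeral)

text \<open>Modulo 2 every generator merely permutes the entries: signs and shifts by 2
  disappear.\<close>

lemma point_reflection_two_odd:
  assumes "i < 4" "p \<in> two_odd"
  shows "point_reflection X i p \<in> two_odd"
proof -
  obtain x y z where p: "p = (x, y, z)" by (cases p)
  have "\<forall>i<4. point_reflection X i (x, y, z) \<in> two_odd"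
    using assms(2) unfolding all_less_4 p
    by (cases X; simp add: point_reflection_simps two_odd_def; argo)
  with assms p show ?thesis by blast
qed

lemma point_reflection_involutive:
  assumes "i < 4"
  shows "point_reflection X i (point_reflection X i p) = p"
proof -
  obtain x y z where p: "p = (x, y, z)" by (cases p)
  have "\<forall>i<4. point_reflection X i (point_reflection X i (x, y, z)) = (x, y, z)"
    unfolding all_less_4 by (cases X) (simp_all add: point_reflection_simps)
  with assms p show ?thesis by blast
qed

lemma sum_root_coeff:
  "(\<Sum>i<4. root_coeff D32 p i) = real_of_int (shifted_norm D32 p - 6) / 8"
  "(\<Sum>i<4. root_coeff B31 p i) = real_of_int (shifted_norm B31 p - 2) / 6"
  by (cases p; simp add: sum_less_4 root_coeff_simps field_simps power2_eq_square)+

text \<open>The left side is coroot \<open>i\<close> on \<Lambda> 2 - \<beta>. The quadratic terms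
  cancel, since they come with multiples of (1, 1, 1, 1) and (1, 1, 2, 2), null vectors of the two
  Cartan matrices.\<close>

lemma pairing_eq:
  assumes "i < 4"
  shows "(if i = 2 then 1 else 0) - (\<Sum>k<4. root_coeff X p k * of_int (cartan X i k))
    = of_int (pairing X p i)"
proof -
  obtain x y z where p: "p = (x, y, z)" by (cases p)
  have "\<forall>i<4. (if i = 2 then 1 else 0)
      - (\<Sum>k<4. root_coeff X (x, y, z) k * of_int (cartan X i k)) = of_int (pairing X (x, y, z) i)"
    unfolding all_less_4 sum_less_4
    by (cases X)
      (simp_all add: root_coeff_simps pairing_simps cartan_def add_divide_distrib
        diff_divide_distrib)
  with assms p show ?thesis by blast
qed

text \<open>For \<open>i > 0\<close> the norm is preserved and only one partial sum of the entries
  changes. For \<open>i = 0\<close> the change of the norm cancels against the linear terms in all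
  coefficients except that of \<open>\<alpha> 0\<close>.\<close>

lemma root_coeff_point_reflection:
  assumes "i < 4" "k < 4"
  shows "root_coeff X (point_reflection X i p) k
    = root_coeff X p k + (if k = i then pairing X p i else 0)"
proof -
  obtain x y z where p: "p = (x, y, z)" by (cases p)
  have "\<forall>i<4. \<forall>k<4. root_coeff X (point_reflection X i (x, y, z)) k
      = root_coeff X (x, y, z) k + (if k = i then pairing X (x, y, z) i else 0)"
    unfolding all_less_4
    by (cases X)
      (simp_all add: point_reflection_simps root_coeff_simps pairing_simps power2_diff
        add_divide_distrib diff_divide_distrib)
  with assms p show ?thesis by simp
qed

lemma root_coeff_inj:
  assumes "\<forall>i<4. root_coeff X p i = root_coeff X p' i"
  shows "p = p'"
proof -
  obtain x y z x' y' z' where p: "p = (x, y, z)" "p' = (x', y', z')"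
    by (cases p; cases p')
  \<comment> \<open>Combinations in which the norm cancels. For \<open>B31\<close> the norm enters
    with weights 1/4, 1/4, 1/2, 1/2, whence the extra term for y.\<close>
  have "real_of_int x = 1 + root_coeff X (x, y, z) 0 - root_coeff X (x, y, z) (Suc 0)"
    "real_of_int y = 1 + root_coeff X (x, y, z) (Suc 0) - root_coeff X (x, y, z) 2 +
       (if X = B31 then root_coeff X (x, y, z) 0 else 0)"
    "real_of_int z = root_coeff X (x, y, z) 2 - root_coeff X (x, y, z) 3"
    for x y z
    by (cases X; simp add: root_coeff_simps add_divide_distrib)+
  note recover = this
  have "real_of_int x = real_of_int x'" "real_of_int y = real_of_int y'"
    "real_of_int z = real_of_int z'"
    using assms unfolding p all_less_4 
      recover[where x = x and y = y and z = z] recover[where x = x' and y = y' and z = z']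
    by (cases X; simp)+
  then show ?thesis by (simp add: p)
qed

text \<open>Outside the fundamental alcove some reflection is a descent, and the alcove contains
  only one vector with exactly two odd entries.\<close>

lemma exists_descent:
  assumes "p \<in> two_odd" "p \<noteq> (1, 1, 0)"
  shows "\<exists>i<4. shifted_norm X (point_reflection X i p) < shifted_norm X p"
proof (rule ccontr)
  obtain x y z where p: "p = (x, y, z)" by (cases p)
  assume "\<not> ?thesis"
  then have min: "shifted_norm X p \<le> shifted_norm X (point_reflection X i p)" if "i < 4" for i
    using that by (meson not_less)
  \<comment> \<open>The difference of the two norms is a positive multiple of one linear form per
    generator, so the absence of a descent gives the walls of the closed alcove.\<close>
  then have "y \<le> x" "z \<le> y" "0 \<le> z" and "x + (if X = D32 then x else y) \<le> 2"
    using min[of 0] min[of "Suc 0"] min[of 2] min[of 3] unfolding p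
    by (cases X; simp add: point_reflection_simps power2_eq_square algebra_simps)+
  then have "x \<le> 2" "y \<le> 1" by (auto split: if_splits)
  with \<open>y \<le> x\<close> \<open>z \<le> y\<close> \<open>0 \<le> z\<close> have "x \<in> {0, 1, 2}" "y \<in> {0, 1}" "z \<in> {0, 1}"
    by auto
  with assms p \<open>y \<le> x\<close> \<open>z \<le> y\<close> \<open>x + (if X = D32 then x else y) \<le> 2\<close> show False
    by (auto simp: two_odd_def split: if_splits)
qed

section \<open>Transfer from integer points to the weight space\<close>

context affine_weights
begin

definition weight :: "int \<times> int \<times> int \<Rightarrow> 'v" where
  "weight p = \<Lambda> 2 - (\<Sum>i<4. root_coeff X p i *\<^sub>R \<alpha> i)"

lemma inj_weight: "inj weight"
  by (rule injI) (simp add: weight_def combination_eq_iff root_coeff_inj)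

lemma weight_base: "weight (1, 1, 0) = \<Lambda> 2"
  unfolding weight_def sum_less_4 by (cases X) (simp_all add: root_coeff_simps)

lemma reflection_weight:
  assumes "i < 4"
  shows "reflection \<alpha> coroot i (weight p) = weight (point_reflection X i p)"
proof -
  have pairing: "coroot i (weight p) = of_int (pairing X p i)"
    unfolding pairing_eq[OF assms, symmetric]
    using assms coroot_fundamental[of 2 i]
    by (auto simp: weight_def coroot_diff coroot_sum coroot_scale coroot_root
        intro!: sum.cong)
  have "(\<Sum>k<4. root_coeff X (point_reflection X i p) k *\<^sub>R \<alpha> k)
      = (\<Sum>k<4. root_coeff X p k *\<^sub>R \<alpha> k + (if k = i then of_int (pairing X p i) *\<^sub>R \<alpha> k else 0))"
    using assms by (intro sum.cong) (auto simp: root_coeff_point_reflection scaleR_add_left)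
  also have "\<dots> = (\<Sum>k<4. root_coeff X p k *\<^sub>R \<alpha> k) + of_int (pairing X p i) *\<^sub>R \<alpha> i"
    using assms by (simp add: sum.distrib)
  finally show ?thesis
    by (simp add: reflection_def pairing) (simp add: weight_def)
qed

text \<open>A descending reflection leads to a point already known to be in the orbit; the same
  reflection leads back.\<close>

lemma weight_mem_orbit: "p \<in> two_odd \<Longrightarrow> weight p \<in> weyl_orbit \<alpha> coroot (\<Lambda> 2)"
proof (induction p rule: measure_induct_rule[where f = "\<lambda>p. nat (shifted_norm X p)"])
  case (less p)
  show ?case
  proof (cases "p = (1, 1, 0)")
    case True
    then show ?thesis by (simp add: weight_base weyl_orbit_self)
  next
    case False
    then obtain i where i: "i < 4" "shifted_norm X (point_reflection X i p) < shifted_norm X p"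
      using exists_descent less.prems by blast
    \<comment> \<open>Nonnegativity keeps the strict decrease under \<open>nat\<close>.\<close>
    have "0 \<le> shifted_norm X (point_reflection X i p)"
      by (cases X; cases "point_reflection X i p") simp_all
    with i have "weight (point_reflection X i p) \<in> weyl_orbit \<alpha> coroot (\<Lambda> 2)"
      by (intro less.IH point_reflection_two_odd less.prems) auto
    then have "reflection \<alpha> coroot i (weight (point_reflection X i p)) \<in> weyl_orbit \<alpha> coroot (\<Lambda> 2)"
      by (rule weyl_orbit_reflection[OF i(1)])
    then show ?thesis
      by (simp add: reflection_weight i point_reflection_involutive)
  qed
qed

lemma weyl_orbit_fundamental: "weyl_orbit \<alpha> coroot (\<Lambda> 2) = weight ` two_odd"
proof
  show "weyl_orbit \<alpha> coroot (\<Lambda> 2) \<subseteq> weight ` two_odd"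
  proof (rule weyl_orbit_subset)
    have "(1, 1, 0) \<in> two_odd" by (simp add: two_odd_def)
    then show "\<Lambda> 2 \<in> weight ` two_odd" using weight_base by (metis imageI)
  qed (auto simp: reflection_weight point_reflection_two_odd)
qed (auto simp: weight_mem_orbit)

lemma ht_weight: "ht \<alpha> (\<Lambda> 2 - weight p) = (\<Sum>i<4. root_coeff X p i)"
  by (simp add: weight_def ht_combination)

lemma cores_eq:
  "cores \<alpha> coroot \<Lambda> 2 N = weight `
     {p \<in> two_odd. shifted_norm X p = int (case X of D32 \<Rightarrow> 8 * N + 6 | B31 \<Rightarrow> 6 * N + 2)}"
proof -
  have "(\<Sum>i<4. root_coeff X p i) = real N \<longleftrightarrow>
      shifted_norm X p = int (case X of D32 \<Rightarrow> 8 * N + 6 | B31 \<Rightarrow> 6 * N + 2)" for p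
  proof (cases X)
    case D32
    have "(\<Sum>i<4. root_coeff X p i) = real N \<longleftrightarrow> real_of_int (shifted_norm X p) = of_int (8 * int N + 6)"
      by (simp add: D32 sum_root_coeff field_simps)
    then show ?thesis by (simp only: of_int_eq_iff) (simp add: D32 add.commute)
  next
    case B31
    have "(\<Sum>i<4. root_coeff X p i) = real N \<longleftrightarrow> real_of_int (shifted_norm X p) = of_int (6 * int N + 2)"
      by (simp add: B31 sum_root_coeff field_simps)
    then show ?thesis by (simp only: of_int_eq_iff) (simp add: B31 add.commute)
  qed
  then show ?thesis
    by (auto simp: cores_def weyl_orbit_fundamental ht_weight)
qed

end

section \<open>Sums of three squares\<close>

definition squares3 :: "nat \<Rightarrow> (int \<times> int \<times> int) set" where
  "squares3 n = {(a, b, c). a\<^sup>2 + b\<^sup>2 + c\<^sup>2 = int n}"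

lemma finite_squares3: "finite (squares3 n)"
proof (rule finite_subset)
  have le: "a \<le> a\<^sup>2" "- a \<le> a\<^sup>2" for a :: int
  proof -
    have "0 \<le> a * (a - 1)" "0 \<le> a * (a + 1)"
      unfolding zero_le_mult_iff by arith+
    then show "a \<le> a\<^sup>2" "- a \<le> a\<^sup>2"
      by (simp_all add: power2_eq_square algebra_simps)
  qed
  show "squares3 n \<subseteq> {- int n..int n} \<times> {- int n..int n} \<times> {- int n..int n}"
  proof clarify
    fix a b c assume "(a, b, c) \<in> squares3 n"
    then have "a\<^sup>2 + b\<^sup>2 + c\<^sup>2 = int n" by (simp add: squares3_def)
    moreover have "x\<^sup>2 \<le> a\<^sup>2 + b\<^sup>2 + c\<^sup>2" if "x \<in> {a, b, c}" for x
      using that by auto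
    ultimately have "- int n \<le> x \<and> x \<le> int n" if "x \<in> {a, b, c}" for x
      using that le[of x] by (metis minus_le_iff order_trans)
    then show "a \<in> {- int n..int n} \<and> (b, c) \<in> {- int n..int n} \<times> {- int n..int n}" by simp
  qed
qed simp

text \<open>The sets where \<open>Q (g i t)\<close> holds partition \<open>A\<close>, and
  \<open>g i\<close> maps each of them bijectively onto the set where \<open>Q\<close>
  holds.\<close>

lemma card_eq_mult_card_class:
  assumes "finite A" "finite I"
    and bij: "\<And>i. i \<in> I \<Longrightarrow> bij_betw (g i) A A"
    and unique: "\<And>t. t \<in> A \<Longrightarrow> \<exists>!i. i \<in> I \<and> Q (g i t)"
  shows "card A = card I * card {t \<in> A. Q t}"
proof -
  have class_card: "card {t \<in> A. Q (g i t)} = card {t \<in> A. Q t}" if "i \<in> I" for i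
  proof -
    have "g i ` {t \<in> A. Q (g i t)} = {t \<in> A. Q t}"
      using bij[OF that] by (auto simp: bij_betw_def)
    moreover have "card (g i ` {t \<in> A. Q (g i t)}) = card {t \<in> A. Q (g i t)}"
      using bij[OF that] by (intro card_image) (auto simp: bij_betw_def intro: inj_on_subset)
    ultimately show ?thesis by simp
  qed
  have "A = (\<Union>i\<in>I. {t \<in> A. Q (g i t)})"
    using unique by blast
  then have "card A = card (\<Union>i\<in>I. {t \<in> A. Q (g i t)})" by simp
  also have "\<dots> = (\<Sum>i\<in>I. card {t \<in> A. Q (g i t)})"
    using assms(1,2) unique by (intro card_UN_disjoint) auto
  also have "\<dots> = card I * card {t \<in> A. Q t}"
    using class_card by simp
  finally show ?thesis .
qed

lemma card_eq_double:
  assumes "finite A" and f: "\<And>t. t \<in> A \<Longrightarrow> f t \<in> A \<and> f (f t) = t \<and> (Q (f t) \<longleftrightarrow> \<not> Q t)"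
  shows "card A = 2 * card {t \<in> A. Q t}"
proof -
  have "card A = card (UNIV :: bool set) * card {t \<in> A. Q t}"
  proof (rule card_eq_mult_card_class[where g = "\<lambda>i. if i then f else id"])
    have "bij_betw f A A"
      by (rule bij_betwI[where g = f]) (use f in auto)
    then show "bij_betw (if i then f else id) A A" for i by (cases i) auto
    show "\<exists>!i. i \<in> UNIV \<and> Q ((if i then f else id) t)" if "t \<in> A" for t
      by (rule ex1I[where a = "\<not> Q t"]) (use f[OF that] in \<open>auto split: if_splits\<close>)
  qed (use assms in auto)
  then show ?thesis by simp
qed

lemma card_eq_triple:
  assumes "finite A"
    and f: "\<And>a b c. (a, b, c) \<in> A \<Longrightarrow> (b, c, a) \<in> A"
    and Q: "\<And>a b c. (a, b, c) \<in> A \<Longrightarrow>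
      Q a b c \<and> \<not> Q b c a \<and> \<not> Q c a b \<or> \<not> Q a b c \<and> Q b c a \<and> \<not> Q c a b \<or>
      \<not> Q a b c \<and> \<not> Q b c a \<and> Q c a b"
  shows "card A = 3 * card {(a, b, c) \<in> A. Q a b c}"
proof -
  define g :: "nat \<Rightarrow> 'a \<times> 'a \<times> 'a \<Rightarrow> 'a \<times> 'a \<times> 'a" where
    "g = (\<lambda>i (a, b, c). [(a, b, c), (b, c, a), (c, a, b)] ! i)"
  have g: "g 0 (a, b, c) = (a, b, c)" "g 1 (a, b, c) = (b, c, a)" "g 2 (a, b, c) = (c, a, b)" for a b c
    by (simp_all add: g_def)
  have "card A = card {0, 1, 2::nat} * card {t \<in> A. (\<lambda>(a, b, c). Q a b c) t}"
  proof (rule card_eq_mult_card_class[where g = g])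
    have "bij_betw (g 0) A A"
      by (rule bij_betwI[where g = "g 0"]) (auto simp: g f)
    moreover have "bij_betw (g 1) A A"
      by (rule bij_betwI[where g = "g 2"]) (auto simp: g f simp del: One_nat_def)
    moreover have "bij_betw (g 2) A A"
      by (rule bij_betwI[where g = "g 1"]) (auto simp: g f simp del: One_nat_def)
    ultimately show "bij_betw (g i) A A" if "i \<in> {0, 1, 2}" for i
      using that by auto
    show "\<exists>!i. i \<in> {0, 1, 2} \<and> (\<lambda>(a, b, c). Q a b c) (g i t)" if "t \<in> A" for t
    proof -
      obtain a b c where t: "t = (a, b, c)" by (cases t)
      show ?thesis using Q[of a b c] that unfolding t Ex1_def
        by (auto simp: g simp del: One_nat_def)
    qed
  qed (use assms in auto)
  then show ?thesis by (simp add: case_prod_unfold)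
qed

lemma r3_eq: "r3 n = card (squares3 n)"
  by (simp add: r3_def squares3_def)

section \<open>Squares modulo 8, 4 and 3\<close>

lemma square_mod_8:
  fixes a :: int
  shows "a\<^sup>2 mod 8 = (if odd a then 1 else if a mod 4 = 2 then 4 else 0)"
proof -
  define q r where "q = a div 4" and "r = a mod 4"
  have a: "a = 4 * q + r" by (simp add: q_def r_def)
  have "r \<in> {0, 1, 2, 3}" unfolding r_def by simp presburger
  moreover have "a\<^sup>2 = r\<^sup>2 + 8 * (2 * q\<^sup>2 + q * r)"
    by (simp add: a power2_eq_square algebra_simps)
  then have "a\<^sup>2 mod 8 = r\<^sup>2 mod 8" by (simp only: mod_mult_self2)
  moreover have "odd a \<longleftrightarrow> odd r" by (simp add: a)
  ultimately show ?thesis unfolding r_def[symmetric] by auto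
qed

lemma square_mod_4:
  fixes a :: int
  shows "a\<^sup>2 mod 4 = (if odd a then 1 else 0)"
proof -
  have "a\<^sup>2 mod 4 = a\<^sup>2 mod 8 mod 4" by (simp add: mod_mod_cancel)
  then show ?thesis by (simp add: square_mod_8)
qed

lemma square_mod_3:
  fixes a :: int
  shows "a\<^sup>2 mod 3 = (if 3 dvd a then 0 else 1)"
proof -
  have "a mod 3 \<in> {0, 1, 2}" by simp presburger
  moreover have "a\<^sup>2 mod 3 = (a mod 3)\<^sup>2 mod 3" by (simp add: power_mod)
  ultimately have "a\<^sup>2 mod 3 = (if a mod 3 = 0 then 0 else 1)" by auto
  then show ?thesis by (simp only: dvd_eq_mod_eq_0)
qed

text \<open>With summands 0, 1, 4 the residue 6 arises only as 1 + 1 + 4.\<close>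

lemma squares3_mod_8:
  assumes "(a, b, c) \<in> squares3 (8 * N + 6)"
  shows "odd a \<and> b mod 4 = 2 \<and> odd c \<or> a mod 4 = 2 \<and> odd b \<and> odd c \<or>
    odd a \<and> odd b \<and> c mod 4 = 2"
proof -
  have key: "(((if P then 1 else if P' then 4 else 0) + (if Q then 1 else if Q' then 4 else 0)) mod 8
      + (if R then 1 else if R' then 4 else 0)) mod 8 = (6::int)
    \<Longrightarrow> P \<and> Q' \<and> R \<or> P' \<and> Q \<and> R \<or> P \<and> Q \<and> R'" for P P' Q Q' R R'
    by (cases P; cases P'; cases Q; cases Q'; cases R; cases R') simp_all
  have "a\<^sup>2 + b\<^sup>2 + c\<^sup>2 = 6 + 8 * int N" using assms by (simp add: squares3_def)
  then have "(a\<^sup>2 + b\<^sup>2 + c\<^sup>2) mod 8 = 6" by simp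
  then have "((a\<^sup>2 mod 8 + b\<^sup>2 mod 8) mod 8 + c\<^sup>2 mod 8) mod 8 = 6"
    by (simp only: mod_add_eq)
  then show ?thesis unfolding square_mod_8 by (rule key)
qed

lemma squares3_mod_3:
  assumes "(a, b, c) \<in> squares3 (6 * N + 2)"
  shows "3 dvd a \<and> \<not> 3 dvd b \<and> \<not> 3 dvd c \<or> \<not> 3 dvd a \<and> 3 dvd b \<and> \<not> 3 dvd c \<or>
    \<not> 3 dvd a \<and> \<not> 3 dvd b \<and> 3 dvd c"
proof -
  have key: "(((if P then 0 else 1) + (if Q then 0 else 1)) mod 3 + (if R then 0 else 1)) mod 3 = (2::int)
    \<Longrightarrow> P \<and> \<not> Q \<and> \<not> R \<or> \<not> P \<and> Q \<and> \<not> R \<or> \<not> P \<and> \<not> Q \<and> R" for P Q R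
    by (cases P; cases Q; cases R) simp_all
  have "a\<^sup>2 + b\<^sup>2 + c\<^sup>2 = 2 + 3 * (2 * int N)" using assms by (simp add: squares3_def)
  then have "(a\<^sup>2 + b\<^sup>2 + c\<^sup>2) mod 3 = 2" by (simp only: mod_mult_self2) simp
  then have "((a\<^sup>2 mod 3 + b\<^sup>2 mod 3) mod 3 + c\<^sup>2 mod 3) mod 3 = 2"
    by (simp only: mod_add_eq)
  then show ?thesis unfolding square_mod_3 by (rule key)
qed

lemma squares3_closed:
  assumes "(a, b, c) \<in> squares3 n"
  shows "(b, c, a) \<in> squares3 n" "(- a, b, c) \<in> squares3 n" "(a, - b, c) \<in> squares3 n"
    "(a, b, - c) \<in> squares3 n"
  using assms by (simp_all add: squares3_def algebra_simps)

lemma neg_mod_4: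
  fixes a :: int
  assumes "odd a"
  shows "(- a) mod 4 = 1 \<longleftrightarrow> a mod 4 \<noteq> 1" "(- a) mod 4 = 3 \<longleftrightarrow> a mod 4 \<noteq> 3"
  using assms by presburger+

lemma neg_mod_3:
  fixes a :: int
  assumes "\<not> 3 dvd a"
  shows "(- a) mod 3 = 1 \<longleftrightarrow> a mod 3 \<noteq> 1" "(- a) mod 3 = 2 \<longleftrightarrow> a mod 3 \<noteq> 2"
  using assms by presburger+

section \<open>Normal forms for all representations\<close>

lemma r3_D32: "r3 (8 * N + 6) = 12 * card {p. shifted_norm D32 p = int (8 * N + 6)}"
proof -
  let ?R = "squares3 (8 * N + 6)"
  \<comment> \<open>Normalise the place of the even entry, then the signs of the first and third
    entries, giving 3 * 2 * 2. The middle entry is 2 modulo 4 for either sign and costs no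
    factor.\<close>
  define A where "A = {(a, b, c) \<in> ?R. even b}"
  define B where "B = {t \<in> A. (\<lambda>(a, b, c). a mod 4 = 1) t}"
  define C where "C = {t \<in> B. (\<lambda>(a, b, c). c mod 4 = 3) t}"
  have parity: "odd a \<and> b mod 4 = 2 \<and> odd c" if "(a, b, c) \<in> ?R" "even b" for a b c
    using squares3_mod_8[OF that(1)] that(2) by blast
  have "card ?R = 3 * card A"
    unfolding A_def
  proof (rule card_eq_triple)
    have "even x" if "x mod 4 = 2" for x :: int using that by presburger
    then show "even b \<and> odd c \<and> odd a \<or> odd b \<and> even c \<and> odd a \<or> odd b \<and> odd c \<and> even a"
      if "(a, b, c) \<in> ?R" for a b c
      using squares3_mod_8[OF that] by blast
  qed (auto simp: finite_squares3 squares3_closed)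
  also have "card A = 2 * card B"
    unfolding B_def
    by (rule card_eq_double[where f = "\<lambda>(a, b, c). (- a, b, c)"])
      (auto simp: A_def finite_squares3 squares3_closed neg_mod_4 dest: parity
        intro: finite_subset[OF _ finite_squares3])
  also have "card B = 2 * card C"
    unfolding C_def
    by (rule card_eq_double[where f = "\<lambda>(a, b, c). (a, b, - c)"])
      (auto simp: B_def A_def finite_squares3 squares3_closed neg_mod_4 dest: parity
        intro: finite_subset[OF _ finite_squares3])
  also have "C = (\<lambda>(x, y, z). (4 * x - 3, 4 * y - 2, 4 * z - 1))
      ` {p. shifted_norm D32 p = int (8 * N + 6)}"
  proof (intro equalityI subsetI)
    fix t assume "t \<in> C"
    then obtain a b c where t: "t = (a, b, c)" "(a, b, c) \<in> ?R" "even b" "a mod 4 = 1" "c mod 4 = 3"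
      by (auto simp: C_def B_def A_def)
    from parity[OF t(2,3)] have "b mod 4 = 2" by blast
    with t(4,5) have "a = 4 * ((a + 3) div 4) - 3" "b = 4 * ((b + 2) div 4) - 2"
      "c = 4 * ((c + 1) div 4) - 1" by presburger+
    then obtain x y z where "a = 4 * x - 3" "b = 4 * y - 2" "c = 4 * z - 1" by blast
    with t show "t \<in> (\<lambda>(x, y, z). (4 * x - 3, 4 * y - 2, 4 * z - 1))
        ` {p. shifted_norm D32 p = int (8 * N + 6)}"
      by (intro image_eqI[where x = "(x, y, z)"]) (auto simp: squares3_def)
  next
    have "(4 * x - 3) mod 4 = 1" "(4 * x - 1) mod 4 = 3" for x :: int by presburger+
    then show "t \<in> C" if "t \<in> (\<lambda>(x, y, z). (4 * x - 3, 4 * y - 2, 4 * z - 1))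
        ` {p. shifted_norm D32 p = int (8 * N + 6)}" for t
      using that by (auto simp: C_def B_def A_def squares3_def)
  qed
  also have "card \<dots> = card {p. shifted_norm D32 p = int (8 * N + 6)}"
    by (rule card_image) (auto simp: inj_on_def)
  finally show ?thesis by (simp add: r3_eq)
qed

lemma r3_B31: "r3 (6 * N + 2) = 12 * card {p. shifted_norm B31 p = int (6 * N + 2)}"
proof -
  let ?R = "squares3 (6 * N + 2)"
  \<comment> \<open>Here the multiple of 3 goes first, and its sign is free because
    \<open>3 * x - 3\<close> runs through all multiples of 3.\<close>
  define A where "A = {(a, b, c) \<in> ?R. 3 dvd a}"
  define B where "B = {t \<in> A. (\<lambda>(a, b, c). b mod 3 = 1) t}"
  define C where "C = {t \<in> B. (\<lambda>(a, b, c). c mod 3 = 2) t}"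
  have nonzero: "\<not> 3 dvd b \<and> \<not> 3 dvd c" if "(a, b, c) \<in> ?R" "3 dvd a" for a b c
    using squares3_mod_3[OF that(1)] that(2) by simp
  have "card ?R = 3 * card A"
    unfolding A_def
  proof (rule card_eq_triple)
    show "3 dvd a \<and> \<not> 3 dvd b \<and> \<not> 3 dvd c \<or> \<not> 3 dvd a \<and> 3 dvd b \<and> \<not> 3 dvd c \<or>
        \<not> 3 dvd a \<and> \<not> 3 dvd b \<and> 3 dvd c"
      if "(a, b, c) \<in> ?R" for a b c
      by (rule squares3_mod_3[OF that])
  qed (auto simp: finite_squares3 squares3_closed)
  also have "card A = 2 * card B"
    unfolding B_def
    by (rule card_eq_double[where f = "\<lambda>(a, b, c). (a, - b, c)"])
      (auto simp: A_def finite_squares3 squares3_closed neg_mod_3 simp del: add_2_eq_Suc'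
        dest: nonzero
        intro: finite_subset[OF _ finite_squares3])
  also have "card B = 2 * card C"
    unfolding C_def
    by (rule card_eq_double[where f = "\<lambda>(a, b, c). (a, b, - c)"])
      (auto simp: B_def A_def finite_squares3 squares3_closed neg_mod_3 simp del: add_2_eq_Suc'
        dest: nonzero
        intro: finite_subset[OF _ finite_squares3])
  also have "C = (\<lambda>(x, y, z). (3 * x - 3, 3 * y - 2, 3 * z - 1))
      ` {p. shifted_norm B31 p = int (6 * N + 2)}"
  proof (intro equalityI subsetI)
    fix t assume "t \<in> C"
    then obtain a b c where t: "t = (a, b, c)" "(a, b, c) \<in> ?R" "3 dvd a" "b mod 3 = 1"
      "c mod 3 = 2"
      by (auto simp: C_def B_def A_def)
    then have "a = 3 * ((a + 3) div 3) - 3" "b = 3 * ((b + 2) div 3) - 2"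
      "c = 3 * ((c + 1) div 3) - 1" by presburger+
    then obtain x y z where "a = 3 * x - 3" "b = 3 * y - 2" "c = 3 * z - 1" by blast
    with t show "t \<in> (\<lambda>(x, y, z). (3 * x - 3, 3 * y - 2, 3 * z - 1))
        ` {p. shifted_norm B31 p = int (6 * N + 2)}"
      by (intro image_eqI[where x = "(x, y, z)"]) (auto simp: squares3_def)
  next
    have "3 dvd (3 * x - 3)" "(3 * x - 2) mod 3 = 1" "(3 * x - 1) mod 3 = 2" for x :: int
      by presburger+
    then show "t \<in> C" if "t \<in> (\<lambda>(x, y, z). (3 * x - 3, 3 * y - 2, 3 * z - 1))
        ` {p. shifted_norm B31 p = int (6 * N + 2)}" for t
      using that by (auto simp: C_def B_def A_def squares3_def)
  qed
  also have "card \<dots> = card {p. shifted_norm B31 p = int (6 * N + 2)}"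
    by (rule card_image) (auto simp: inj_on_def)
  finally show ?thesis by (simp add: r3_eq)
qed

lemma finite_shifted_norm: "finite {p. shifted_norm X p = int n}"
proof (cases X)
  case D32
  have "inj_on (\<lambda>(x, y, z). (4 * x - 3, 4 * y - 2, 4 * z - 1)) {p. shifted_norm X p = int n}"
    by (auto simp: inj_on_def)
  then show ?thesis
    by (rule inj_on_finite[OF _ _ finite_squares3[of n]]) (auto simp: D32 squares3_def)
next
  case B31
  have "inj_on (\<lambda>(x, y, z). (3 * x - 3, 3 * y - 2, 3 * z - 1)) {p. shifted_norm X p = int n}"
    by (auto simp: inj_on_def)
  then show ?thesis
    by (rule inj_on_finite[OF _ _ finite_squares3[of n]]) (auto simp: B31 squares3_def)
qed

section \<open>Selecting the solutions with exactly two odd entries\<close>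

lemma shifted_norm_D32_parity:
  assumes "shifted_norm D32 (x, y, z) = int (8 * N + 6)"
  shows "even N \<longleftrightarrow> odd (x + z)"
proof -
  have "int N = x + z + 1 + 2 * (x\<^sup>2 - 2 * x + y\<^sup>2 - y + z\<^sup>2 - z)"
    using assms by (simp add: power2_eq_square algebra_simps)
  then have "even (int N) \<longleftrightarrow> even (x + z + 1)"
    by (simp only: even_iff_mod_2_eq_zero mod_mult_self2)
  then show ?thesis by (simp only: even_plus_one_iff even_of_nat)
qed

text \<open>For odd \<open>N\<close> the number \<open>6 * N + 2\<close> is divisible by 4, which
  forces all three squares to be even.\<close>

lemma shifted_norm_B31_parity:
  assumes "shifted_norm B31 (x, y, z) = int (6 * N + 2)" "odd N"
  shows "odd x \<and> even y \<and> odd z"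
proof -
  obtain k where "N = 2 * k + 1" using assms(2) by (rule oddE)
  then have "((3 * x - 3)\<^sup>2 + (3 * y - 2)\<^sup>2 + (3 * z - 1)\<^sup>2) = 4 * (3 * int k + 2)"
    using assms(1) by simp
  then have "((3 * x - 3)\<^sup>2 + (3 * y - 2)\<^sup>2 + (3 * z - 1)\<^sup>2) mod 4 = 0" by simp
  then have "(((3 * x - 3)\<^sup>2 mod 4 + (3 * y - 2)\<^sup>2 mod 4) mod 4 + (3 * z - 1)\<^sup>2 mod 4) mod 4 = 0"
    by (simp only: mod_add_eq)
  then have "even (3 * x - 3) \<and> even (3 * y - 2) \<and> even (3 * z - 1)"
    unfolding square_mod_4 by (simp split: if_splits)
  then show ?thesis by simp
qed

text \<open>Exactly one of x and z is odd, so membership in \<open>two_odd\<close> amounts to y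
  being odd; \<open>1 - y\<close> flips this and only negates \<open>4 * y - 2\<close>.\<close>

lemma card_D32_even:
  assumes "even N"
  shows "r3 (8 * N + 6) = 24 * card {p \<in> two_odd. shifted_norm D32 p = int (8 * N + 6)}"
proof -
  let ?E = "{p. shifted_norm D32 p = int (8 * N + 6)}"
  have "card ?E = 2 * card {p \<in> ?E. (\<lambda>(x, y, z). odd y) p}"
    by (rule card_eq_double[OF finite_shifted_norm, where f = "\<lambda>(x, y, z). (x, 1 - y, z)"])
      (auto simp: power2_eq_square algebra_simps)
  also have "{p \<in> ?E. (\<lambda>(x, y, z). odd y) p} = {p \<in> two_odd. p \<in> ?E}"
    using assms shifted_norm_D32_parity by (fastforce simp: two_odd_def simp del: shifted_norm.simps)
  finally show ?thesis by (simp add: r3_D32)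
qed

text \<open>Now x and z have equal parity, so y must be even and z odd. The second involution
  exchanges \<open>4 * x - 3\<close> and \<open>4 * z - 1\<close> up to sign, and flips the common
  parity of x and z.\<close>

lemma card_D32_odd:
  assumes "odd N"
  shows "r3 (8 * N + 6) = 48 * card {p \<in> two_odd. shifted_norm D32 p = int (8 * N + 6)}"
proof -
  let ?E = "{p. shifted_norm D32 p = int (8 * N + 6)}"
  define F where "F = {p \<in> ?E. (\<lambda>(x, y, z). even y) p}"
  have "card ?E = 2 * card F"
    unfolding F_def
    by (rule card_eq_double[OF finite_shifted_norm, where f = "\<lambda>(x, y, z). (x, 1 - y, z)"])
      (auto simp: power2_eq_square algebra_simps)
  also have "card F = 2 * card {p \<in> F. (\<lambda>(x, y, z). odd z) p}"
  proof (rule card_eq_double[where f = "\<lambda>(x, y, z). (1 - z, y, 1 - x)"])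
    show "finite F" unfolding F_def using finite_shifted_norm[of D32 "8 * N + 6"] by simp
    fix t assume "t \<in> F"
    then obtain x y z where t: "t = (x, y, z)" "shifted_norm D32 (x, y, z) = int (8 * N + 6)" "even y"
      by (auto simp: F_def simp del: shifted_norm.simps)
    moreover have "even (x + z)" using shifted_norm_D32_parity[OF t(2)] assms by simp
    moreover have "shifted_norm D32 (1 - z, y, 1 - x) = shifted_norm D32 (x, y, z)"
      by (simp add: power2_eq_square algebra_simps)
    ultimately show "(\<lambda>(x, y, z). (1 - z, y, 1 - x)) t \<in> F \<and>
        (\<lambda>(x, y, z). (1 - z, y, 1 - x)) ((\<lambda>(x, y, z). (1 - z, y, 1 - x)) t) = t \<and>
        ((\<lambda>(x, y, z). odd z) ((\<lambda>(x, y, z). (1 - z, y, 1 - x)) t) \<longleftrightarrow> \<not> (\<lambda>(x, y, z). odd z) t)"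
      by (auto simp: F_def simp del: shifted_norm.simps)
  qed
  also have "{p \<in> F. (\<lambda>(x, y, z). odd z) p} = {p \<in> two_odd. p \<in> ?E}"
    using assms shifted_norm_D32_parity
    by (fastforce simp: F_def two_odd_def simp del: shifted_norm.simps)
  finally show ?thesis by (simp add: r3_D32)
qed

lemma card_B31_odd:
  assumes "odd N"
  shows "r3 (6 * N + 2) = 12 * card {p \<in> two_odd. shifted_norm B31 p = int (6 * N + 2)}"
proof -
  have "{p. shifted_norm B31 p = int (6 * N + 2)}
      = {p \<in> two_odd. shifted_norm B31 p = int (6 * N + 2)}"
    using shifted_norm_B31_parity[OF _ assms]
    by (auto simp: two_odd_def simp del: shifted_norm.simps)
  then show ?thesis using r3_B31[of N] by simp
qed

theorem theorem5p17:
  fixes X :: affine_type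
    and \<alpha> :: "nat \<Rightarrow> 'v::real_vector"
    and coroot :: "nat \<Rightarrow> 'v \<Rightarrow> real"
    and \<Lambda> :: "nat \<Rightarrow> 'v"
    and j N :: nat
  assumes "affine_weights X \<alpha> coroot \<Lambda>"
  shows "(X = D32 \<and> j = 2 \<and> even N \<longrightarrow>
           finite (cores \<alpha> coroot \<Lambda> j N) \<and>
           real (card (cores \<alpha> coroot \<Lambda> j N)) = 1 / 24 * real (r3 (8 * N + 6))) \<and>
         (X = D32 \<and> j = 2 \<and> odd N \<longrightarrow>
           finite (cores \<alpha> coroot \<Lambda> j N) \<and>
           real (card (cores \<alpha> coroot \<Lambda> j N)) = 1 / 48 * real (r3 (8 * N + 6))) \<and>
         (X = B31 \<and> j = 2 \<and> odd N \<longrightarrow>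
           finite (cores \<alpha> coroot \<Lambda> j N) \<and>
           real (card (cores \<alpha> coroot \<Lambda> j N)) = 1 / 12 * real (r3 (6 * N + 2)))"
proof -
  interpret affine_weights X \<alpha> coroot \<Lambda> by (rule assms)
  let ?n = "case X of D32 \<Rightarrow> 8 * N + 6 | B31 \<Rightarrow> 6 * N + 2"
  have "finite (cores \<alpha> coroot \<Lambda> 2 N)"
    unfolding cores_eq using finite_shifted_norm[of X ?n] by simp
  moreover have "card (cores \<alpha> coroot \<Lambda> 2 N) = card {p \<in> two_odd. shifted_norm X p = int ?n}"
    unfolding cores_eq by (rule card_image) (rule inj_on_subset[OF inj_weight], simp)
  ultimately show ?thesis
    using card_D32_even[of N] card_D32_odd[of N] card_B31_odd[of N] by auto
qed

end
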